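(* Let $\sigma>0$ and $\lambda>0$, and let $Y=x_0+W$ with $x_0\in\mathbb{R}^P$ deterministic and $W\sim\mathcal{N}(0,\sigma^2\mathrm{Id}_P)$. Take $\widehat h(P)>0$ such that $\lim_{P\to\infty}\widehat h(P)=0$ and $\lim_{P\to\infty}P^{-1}\widehat h(P)^{-1}=0$. Then $$\operatorname*{plim}_{P\to\infty}\ \frac1P\left(\widehat{df}\{\mathrm{HT}\}(Y,\lambda,\widehat h(P))-df\{\mathrm{HT}\}(x_0,\lambda)\right)=0 .$$ In particular: 1. $\displaystyle \lim_{P\to\infty}\mathbb{E}_W\left[\tfrac1P\,\widehat{df}\{\mathrm{HT}\}(Y,\lambda,\widehat h(P))\right]=\lim_{P\to\infty}\tfrac1P\,df\{\mathrm{HT}\}(x_0,\lambda)$; and 2. $\displaystyle \lim_{P\to\infty}\mathbb{V}_W\left[\tfrac1P\,\widehat{df}\{\mathrm{HT}\}(Y,\lambda,\widehat h(P))\right]=0$.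
   Context: Hard thresholding: for $y\in\mathbb{R}^P$ and $\lambda>0$, $\mathrm{HT}(y,\lambda)\in\mathbb{R}^P$ is defined by $\mathrm{HT}(y,\lambda)_i=0$ if $|y_i|<\lambda$ and $\mathrm{HT}(y,\lambda)_i=y_i$ otherwise. Degrees of freedom: for $Y=x_0+W$ with $W\sim\mathcal{N}(0,\sigma^2\mathrm{Id}_P)$, $$df\{\mathrm{HT}\}(x_0,\lambda)=\sum_{i=1}^P\frac{\mathrm{cov}(Y_i,\mathrm{HT}(Y,\lambda)_i)}{\sigma^2}.$$ Estimator of the degrees of freedom: for $y\in\mathbb{R}^P$, $\lambda>0$, $h>0$, $$\widehat{df}\{\mathrm{HT}\}(y,\lambda,h)=\#\{|y|>\lambda\}+\frac{\lambda\sqrt{\sigma^2+h^2}}{\sqrt{2\pi}\,\sigma h}\sum_{i=1}^P\left[\exp\left(-\frac{(y_i+\lambda)^2}{2h^2}\right)+\exp\left(-\frac{(y_i-\lambda)^2}{2h^2}\right)\right],$$ where $\#\{|y|>\lambda\}$ is the number of indices $i$ with $|y_i|>\lambda$. $\mathbb{E}_W$ and $\mathbb{V}_W$ denote expectation and variance with respect to $W$, and $\operatorname{plim}$ denotes the limit in probability. The limits are taken as the dimension $P$ tends to infinity, with $x_0=x_0^{(P)}\in\mathbb{R}^P$ for each $P$ and with $\sigma$ and $\lambda$ fixed. *)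

theory Defs
  imports "HOL-Probability.Probability"
begin

text \<open>
  The dimension \<open>P\<close> varies within the statement, so a vector of \<open>P\<close> real entries is a function of
  type \<open>nat \<Rightarrow> real\<close> of which only the entries with index \<open>i < P\<close> are used.
\<close>

text \<open>Lebesgue density of the normal law with mean \<open>0\<close> and covariance matrix \<open>\<sigma>\<^sup>2 Id\<close> in dimension \<open>P\<close>.\<close>

definition isotropic_normal_density :: "nat \<Rightarrow> real \<Rightarrow> (nat \<Rightarrow> real) \<Rightarrow> real" where
  "isotropic_normal_density P \<sigma> w =
     1 / sqrt (2 * pi * \<sigma>\<^sup>2) ^ P * exp (- (\<Sum>i<P. (w i)\<^sup>2) / (2 * \<sigma>\<^sup>2))"

definition isotropic_normal :: "'a measure \<Rightarrow> nat \<Rightarrow> real \<Rightarrow> ('a \<Rightarrow> nat \<Rightarrow> real) \<Rightarrow> bool" where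
  "isotropic_normal M P \<sigma> W \<longleftrightarrow>
     distributed M (\<Pi>\<^sub>M i\<in>{..<P}. lborel) W (\<lambda>w. ennreal (isotropic_normal_density P \<sigma> w))"

definition covariance :: "'a measure \<Rightarrow> ('a \<Rightarrow> real) \<Rightarrow> ('a \<Rightarrow> real) \<Rightarrow> real" where
  "covariance M X Z =
     prob_space.expectation M (\<lambda>\<omega>. (X \<omega> - prob_space.expectation M X) *
                                    (Z \<omega> - prob_space.expectation M Z))"

text \<open>
  Convergence in probability to a constant. The \<open>n\<close>-th variable may live on its own probability
  space \<open>M n\<close>.
\<close>

definition plim_const :: "(nat \<Rightarrow> 'a measure) \<Rightarrow> (nat \<Rightarrow> 'a \<Rightarrow> real) \<Rightarrow> real \<Rightarrow> bool" where
  "plim_const M Z c \<longleftrightarrow>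
     (\<forall>\<epsilon>>0. (\<lambda>n. measure (M n) {\<omega> \<in> space (M n). \<bar>Z n \<omega> - c\<bar> > \<epsilon>}) \<longlonglongrightarrow> 0)"

definition HT :: "(nat \<Rightarrow> real) \<Rightarrow> real \<Rightarrow> nat \<Rightarrow> real" where
  "HT y l i = (if \<bar>y i\<bar> < l then 0 else y i)"

text \<open>
  Degrees of freedom of hard thresholding at \<open>x0\<close> with threshold \<open>l\<close>, for the observation
  \<open>Y = x0 + W\<close> with noise \<open>W\<close> defined on \<open>M\<close>. The value depends on \<open>(M, W)\<close> only through the law of \<open>W\<close>.
\<close>

definition df_HT ::
  "'a measure \<Rightarrow> ('a \<Rightarrow> nat \<Rightarrow> real) \<Rightarrow> nat \<Rightarrow> real \<Rightarrow> (nat \<Rightarrow> real) \<Rightarrow> real \<Rightarrow> real" where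
  "df_HT M W P \<sigma> x0 l =
     (let Y = (\<lambda>\<omega> i. x0 i + W \<omega> i)
      in \<Sum>i<P. covariance M (\<lambda>\<omega>. Y \<omega> i) (\<lambda>\<omega>. HT (Y \<omega>) l i) / \<sigma>\<^sup>2)"

definition df_hat_HT :: "nat \<Rightarrow> real \<Rightarrow> (nat \<Rightarrow> real) \<Rightarrow> real \<Rightarrow> real \<Rightarrow> real" where
  "df_hat_HT P \<sigma> y l h =
     real (card {i. i < P \<and> \<bar>y i\<bar> > l}) +
     l * sqrt (\<sigma>\<^sup>2 + h\<^sup>2) / (sqrt (2 * pi) * \<sigma> * h) *
       (\<Sum>i<P. exp (- (y i + l)\<^sup>2 / (2 * h\<^sup>2)) + exp (- (y i - l)\<^sup>2 / (2 * h\<^sup>2)))"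

end

theory Submission
  imports Defs "HOL-Real_Asymp.Real_Asymp"
begin

text \<open>
  The estimator and the degrees of freedom are both sums over the coordinates, so the proof compares
  them one coordinate at a time, for a normal variable with density \<open>normal_density \<mu> \<sigma>\<close>, and then averages.

  Bias. Integration by parts on the two half-lines beyond \<open>\<plusminus>l\<close> (\<open>stein_hard_threshold\<close>) shows that one
  coordinate contributes to the degrees of freedom the probability of exceeding the threshold plus \<open>l\<close> times
  the density at \<open>l\<close> and \<open>- l\<close>. The estimator replaces the probability by an indicator and the density
  values by Gaussian kernels of width \<open>h\<close>. In expectation such a kernel convolves two normal densities
  (\<open>integral_normal_gauss_kernel\<close>), so the estimator recovers the same expression, except that the
  variance \<open>\<sigma>\<^sup>2\<close> in the exponents has become \<open>\<sigma>\<^sup>2 + h\<^sup>2\<close>. The resulting error is of order \<open>h\<^sup>2\<close>, uniformly in the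
  mean \<open>\<mu>\<close> (\<open>abs_exp_diff_variance_le\<close>, \<open>bias_df_hat_coord\<close>), and so survives averaging over arbitrary
  vectors \<open>x0\<close>.

  Variance. As \<open>h\<close> tends to \<open>0\<close>, one coordinate of the estimator is nonnegative, at most of order \<open>1 / h\<close>, with
  bounded mean, so its second moment is of order \<open>1 / h\<close> (\<open>second_moment_df_hat_coord\<close>). The coordinates are independent, so the
  average has variance of order \<open>1 / P + 1 / (P * h)\<close> (\<open>mean_df_hat_HT\<close>).

  Both bounds tend to \<open>0\<close>, and Chebyshev's inequality turns them into convergence in probability
  (\<open>plim_const_0_if_mean_and_variance\<close>).
\<close>

section \<open>Isotropic normal vectors have independent normal coordinates\<close>

lemma isotropic_normal_density_eq_prod:
  assumes "\<sigma> > 0"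
  shows "isotropic_normal_density P \<sigma> w = (\<Prod>i<P. normal_density 0 \<sigma> (w i))"
  using assms
  by (simp add: isotropic_normal_density_def normal_density_def prod.distrib exp_sum[symmetric]
      sum_negf sum_divide_distrib power_divide prod_dividef)

text \<open>
  Both measures agree on boxes by Tonelli's theorem, and boxes determine a \<open>\<sigma>\<close>-finite product measure.
\<close>

lemma density_PiM_prod_lborel:
  fixes f :: "'i \<Rightarrow> real \<Rightarrow> real"
  assumes I: "finite I" and f[measurable]: "\<And>i. f i \<in> borel_measurable borel"
    and nn: "\<And>i x. 0 \<le> f i x" and p: "\<And>i. sigma_finite_measure (density lborel (f i))"
  shows "density (\<Pi>\<^sub>M i\<in>I. lborel) (\<lambda>x. ennreal (\<Prod>i\<in>I. f i (x i))) = (\<Pi>\<^sub>M i\<in>I. density lborel (f i))"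
proof -
  interpret L: product_sigma_finite "\<lambda>_::'i. lborel :: real measure" by standard
  interpret D: product_sigma_finite "\<lambda>i. density lborel (\<lambda>x. ennreal (f i x))"
    using p by (simp add: product_sigma_finite_def)
  show ?thesis
  proof (rule D.PiM_eqI[OF I])
    show "sets (density (\<Pi>\<^sub>M i\<in>I. lborel) (\<lambda>x. ennreal (\<Prod>i\<in>I. f i (x i)))) =
        sets (\<Pi>\<^sub>M i\<in>I. density lborel (\<lambda>x. ennreal (f i x)))"
      by (auto intro!: sets_PiM_cong)
  next
    fix A :: "'i \<Rightarrow> real set"
    assume "\<And>i. i \<in> I \<Longrightarrow> A i \<in> sets (density lborel (\<lambda>x. ennreal (f i x)))"
    hence A: "A i \<in> sets borel" if "i \<in> I" for i using that by simp
    have PA: "Pi\<^sub>E I A \<in> sets (\<Pi>\<^sub>M i\<in>I. lborel)" using A I by (intro sets_PiM_I_finite) auto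
    have "emeasure (density (\<Pi>\<^sub>M i\<in>I. lborel) (\<lambda>x. ennreal (\<Prod>i\<in>I. f i (x i)))) (Pi\<^sub>E I A)
        = (\<integral>\<^sup>+x. ennreal (\<Prod>i\<in>I. f i (x i)) * indicator (Pi\<^sub>E I A) x \<partial>(\<Pi>\<^sub>M i\<in>I. lborel))"
      using PA by (intro emeasure_density) simp_all
    also have "\<dots> = (\<integral>\<^sup>+x. (\<Prod>i\<in>I. ennreal (f i (x i)) * indicator (A i) (x i)) \<partial>(\<Pi>\<^sub>M i\<in>I. lborel))"
    proof (rule nn_integral_cong)
      fix x assume "x \<in> space (\<Pi>\<^sub>M i\<in>I. (lborel :: real measure))"
      hence "x \<in> extensional I" by (auto simp: space_PiM PiE_def)
      hence "indicator (Pi\<^sub>E I A) x = (\<Prod>i\<in>I. indicator (A i) (x i) :: ennreal)"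
        using I by (auto simp: indicator_def PiE_def Pi_def intro!: prod.neutral prod_zero)
      thus "ennreal (\<Prod>i\<in>I. f i (x i)) * indicator (Pi\<^sub>E I A) x
          = (\<Prod>i\<in>I. ennreal (f i (x i)) * indicator (A i) (x i))"
        using nn by (simp add: prod.distrib prod_ennreal)
    qed
    also have "\<dots> = (\<Prod>i\<in>I. \<integral>\<^sup>+x. ennreal (f i x) * indicator (A i) x \<partial>lborel)"
      using A by (intro L.product_nn_integral_prod I) auto
    also have "\<dots> = (\<Prod>i\<in>I. emeasure (density lborel (\<lambda>x. ennreal (f i x))) (A i))"
      using A by (intro prod.cong refl) (simp add: emeasure_density)
    finally show "emeasure (density (\<Pi>\<^sub>M i\<in>I. lborel) (\<lambda>x. ennreal (\<Prod>i\<in>I. f i (x i)))) (Pi\<^sub>E I A)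
        = (\<Prod>i\<in>I. emeasure (density lborel (\<lambda>x. ennreal (f i x))) (A i))" .
  qed
qed

text \<open>
  The law of \<open>W\<close> is a product of one-dimensional normal laws. Projecting it gives the marginals, and
  the product form itself is independence.
\<close>

lemma isotropic_normal_coordinates:
  assumes M: "prob_space M" and \<sigma>: "\<sigma> > 0" and W: "isotropic_normal M P \<sigma> W"
  shows "\<And>i. i < P \<Longrightarrow> distributed M lborel (\<lambda>\<omega>. W \<omega> i) (normal_density 0 \<sigma>)"
    and "prob_space.indep_vars M (\<lambda>_. borel) (\<lambda>i \<omega>. W \<omega> i) {..<P}"
proof -
  interpret prob_space M by fact
  let ?N = "density lborel (\<lambda>x. ennreal (normal_density 0 \<sigma> x))"
  have pN: "prob_space ?N" using prob_space_normal_density[OF \<sigma>] .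
  have "distr M (\<Pi>\<^sub>M i\<in>{..<P}. lborel) W
      = density (\<Pi>\<^sub>M i\<in>{..<P}. lborel) (\<lambda>w. ennreal (\<Prod>i<P. normal_density 0 \<sigma> (w i)))"
    using W by (simp add: isotropic_normal_def distributed_def isotropic_normal_density_eq_prod[OF \<sigma>])
  also have "\<dots> = (\<Pi>\<^sub>M i\<in>{..<P}. ?N)"
    using prob_space_imp_sigma_finite[OF pN] by (intro density_PiM_prod_lborel) auto
  finally have law: "distr M (\<Pi>\<^sub>M i\<in>{..<P}. lborel) W = (\<Pi>\<^sub>M i\<in>{..<P}. ?N)" .
  have Wm: "W \<in> measurable M (\<Pi>\<^sub>M i\<in>{..<P}. lborel)"
    using W by (simp add: isotropic_normal_def distributed_def)
  have Wi[measurable]: "(\<lambda>\<omega>. W \<omega> i) \<in> borel_measurable M" if "i < P" for i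
    using measurable_compose[OF Wm measurable_component_singleton[of i]] that by simp
  have di: "distr M lborel (\<lambda>\<omega>. W \<omega> i) = ?N" if "i < P" for i
  proof -
    have "distr M lborel (\<lambda>\<omega>. W \<omega> i) = distr (distr M (\<Pi>\<^sub>M i\<in>{..<P}. lborel) W) lborel (\<lambda>w. w i)"
      using that Wm by (subst distr_distr) (auto simp: comp_def)
    also have "\<dots> = distr (\<Pi>\<^sub>M i\<in>{..<P}. ?N) ?N (\<lambda>w. w i)"
      unfolding law by (rule distr_cong) auto
    also have "\<dots> = ?N" using that pN by (intro distr_PiM_component) auto
    finally show ?thesis .
  qed
  show "distributed M lborel (\<lambda>\<omega>. W \<omega> i) (normal_density 0 \<sigma>)" if "i < P" for i
    unfolding distributed_def using di[OF that] Wi[OF that] by simp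
  show "indep_vars (\<lambda>_. borel) (\<lambda>i \<omega>. W \<omega> i) {..<P}"
  proof (cases "P = 0")
    case True
    show ?thesis unfolding True
      by (simp add: indep_vars_def indep_sets_def)
  next
    case False
    have "distr M (\<Pi>\<^sub>M i\<in>{..<P}. borel) (\<lambda>\<omega>. \<lambda>i\<in>{..<P}. W \<omega> i) = distr M (\<Pi>\<^sub>M i\<in>{..<P}. lborel) W"
    proof (rule distr_cong)
      fix \<omega> assume "\<omega> \<in> space M"
      hence "W \<omega> \<in> extensional {..<P}"
        using measurable_space[OF Wm] by (auto simp: space_PiM PiE_def)
      thus "(\<lambda>i\<in>{..<P}. W \<omega> i) = W \<omega>" by (rule extensional_restrict)
    qed (auto intro!: sets_PiM_cong)
    also have "\<dots> = (\<Pi>\<^sub>M i\<in>{..<P}. distr M borel (\<lambda>\<omega>. W \<omega> i))"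
    proof -
      have "distr M borel (\<lambda>\<omega>. W \<omega> i) = ?N" if "i < P" for i
        using di[OF that] by (metis distr_cong sets_lborel)
      thus ?thesis unfolding law by (intro PiM_cong) auto
    qed
    finally show ?thesis
      using False by (subst indep_vars_iff_distr_eq_PiM') (auto simp: lessThan_empty_iff)
  qed
qed

text \<open>
  Square integrability of the sum is part of the claim because the induction needs it to expand the
  variance of the partial sum.
\<close>

lemma (in prob_space) variance_sum_indep:
  fixes X :: "'i \<Rightarrow> 'a \<Rightarrow> real"
  assumes "finite I" and "indep_vars (\<lambda>_. borel) X I"
    and "\<And>i. i \<in> I \<Longrightarrow> integrable M (\<lambda>\<omega>. (X i \<omega>)\<^sup>2)"
  shows "variance (\<lambda>\<omega>. \<Sum>i\<in>I. X i \<omega>) = (\<Sum>i\<in>I. variance (X i))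
    \<and> integrable M (\<lambda>\<omega>. (\<Sum>i\<in>I. X i \<omega>)\<^sup>2)"
  using assms
proof (induction I rule: finite_induct)
  case empty
  show ?case by simp
next
  case (insert i I)
  let ?S = "\<lambda>\<omega>. \<Sum>j\<in>I. X j \<omega>"
  have indI: "indep_vars (\<lambda>_. borel) X I"
    using insert.prems(1) by (rule indep_vars_subset) auto
  have IH: "variance ?S = (\<Sum>j\<in>I. variance (X j))" and S2: "integrable M (\<lambda>\<omega>. (?S \<omega>)\<^sup>2)"
    using insert.IH[OF indI] insert.prems(2) by auto
  have rv[measurable]: "X j \<in> borel_measurable M" if "j \<in> insert i I" for j
    using insert.prems(1) that by (auto simp: indep_vars_def)
  have X2: "integrable M (\<lambda>\<omega>. (X i \<omega>)\<^sup>2)" using insert.prems(2) by simp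
  have X1: "integrable M (X i)" using X2 by (rule square_integrable_imp_integrable[rotated]) simp
  have S1: "integrable M ?S" using S2 by (rule square_integrable_imp_integrable[rotated]) simp
  have ind: "indep_var borel (X i) borel ?S"
    using insert.hyps insert.prems(1) by (intro indep_vars_sum)
  have XS: "integrable M (\<lambda>\<omega>. X i \<omega> * ?S \<omega>)"
    and EXS: "expectation (\<lambda>\<omega>. X i \<omega> * ?S \<omega>) = expectation (X i) * expectation ?S"
    using indep_var_integrable[OF ind X1 S1] indep_var_lebesgue_integral[OF ind X1 S1] by auto
  have sq: "(X i \<omega> + ?S \<omega>)\<^sup>2 = (X i \<omega>)\<^sup>2 + (?S \<omega>)\<^sup>2 + 2 * (X i \<omega> * ?S \<omega>)" for \<omega>
    by (simp add: power2_eq_square algebra_simps)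
  have T1: "integrable M (\<lambda>\<omega>. X i \<omega> + ?S \<omega>)" using X1 S1 by (rule Bochner_Integration.integrable_add)
  have T2: "integrable M (\<lambda>\<omega>. (X i \<omega> + ?S \<omega>)\<^sup>2)"
    unfolding sq using X2 S2 XS by (intro Bochner_Integration.integrable_add integrable_mult_right)
  have E2: "expectation (\<lambda>\<omega>. (X i \<omega> + ?S \<omega>)\<^sup>2) = expectation (\<lambda>\<omega>. (X i \<omega>)\<^sup>2)
      + expectation (\<lambda>\<omega>. (?S \<omega>)\<^sup>2) + 2 * (expectation (X i) * expectation ?S)"
    unfolding sq using X2 S2 XS EXS by simp
  have E1: "expectation (\<lambda>\<omega>. X i \<omega> + ?S \<omega>) = expectation (X i) + expectation ?S"
    using X1 S1 by (rule Bochner_Integration.integral_add)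
  have "variance (\<lambda>\<omega>. X i \<omega> + ?S \<omega>)
      = expectation (\<lambda>\<omega>. (X i \<omega> + ?S \<omega>)\<^sup>2) - (expectation (\<lambda>\<omega>. X i \<omega> + ?S \<omega>))\<^sup>2"
    by (rule variance_eq[OF T1 T2])
  also have "\<dots> = variance (X i) + variance ?S"
    unfolding variance_eq[OF X1 X2] variance_eq[OF S1 S2] E1 E2
    by (simp add: power2_sum)
  finally have "variance (\<lambda>\<omega>. X i \<omega> + ?S \<omega>) = variance (X i) + variance ?S" .
  with IH T2 insert.hyps show ?case by simp
qed

section \<open>Gaussian integrals\<close>

lemma tendsto_id_times_normal_density:
  assumes "\<sigma> > 0"
  shows "((\<lambda>y. - y * normal_density \<mu> \<sigma> y) \<longlongrightarrow> 0) at_top"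
    and "((\<lambda>y. - y * normal_density \<mu> \<sigma> y) \<longlongrightarrow> 0) at_bot"
  unfolding normal_density_def using assms by real_asymp+

lemma has_derivative_id_times_normal_density:
  assumes "\<sigma> > 0"
  shows "((\<lambda>y. - y * normal_density \<mu> \<sigma> y) has_real_derivative
           ((y - \<mu>) * y / \<sigma>\<^sup>2 - 1) * normal_density \<mu> \<sigma> y) (at y)"
proof -
  have "(normal_density \<mu> \<sigma> has_real_derivative - (y - \<mu>) / \<sigma>\<^sup>2 * normal_density \<mu> \<sigma> y) (at y)"
  proof -
    have "((\<lambda>y. exp (- (y - \<mu>)\<^sup>2 / (2 * \<sigma>\<^sup>2))) has_real_derivative
        - (y - \<mu>) / \<sigma>\<^sup>2 * exp (- (y - \<mu>)\<^sup>2 / (2 * \<sigma>\<^sup>2))) (at y)"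
      using assms by (auto intro!: derivative_eq_intros simp: field_simps)
    from DERIV_cmult[OF this, of "1 / sqrt (2 * pi * \<sigma>\<^sup>2)"] show ?thesis
      by (simp add: normal_density_def[abs_def] mult.commute)
  qed
  note DERIV_mult[OF DERIV_minus[OF DERIV_ident] this]
  thus ?thesis by (simp add: algebra_simps diff_divide_distrib)
qed

lemma integrable_normal_density_moments:
  assumes "\<sigma> > 0"
  shows "integrable lborel (\<lambda>y. normal_density \<mu> \<sigma> y * ((y - \<mu>) * y))"
    and "integrable lborel (\<lambda>y. normal_density \<mu> \<sigma> y * (y - \<mu>))"
    and "integrable lborel (\<lambda>y. normal_density \<mu> \<sigma> y * y)"
proof -
  show 1: "integrable lborel (\<lambda>y. normal_density \<mu> \<sigma> y * (y - \<mu>))"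
    using integrable_normal_moment[OF assms, of \<mu> 1] by simp
  have "integrable lborel (\<lambda>y. normal_density \<mu> \<sigma> y * (y - \<mu>)\<^sup>2 + \<mu> * (normal_density \<mu> \<sigma> y * (y - \<mu>)))"
    using integrable_normal_moment[OF assms, of \<mu> 2] 1 by auto
  thus "integrable lborel (\<lambda>y. normal_density \<mu> \<sigma> y * ((y - \<mu>) * y))"
    by (simp add: power2_eq_square algebra_simps)
  show "integrable lborel (\<lambda>y. normal_density \<mu> \<sigma> y * y)"
    using integrable_normal_moment_nz_1[OF assms] .
qed

text \<open>
  Stein's integration by parts restricted to a half-line. The integrand \<open>f\<close> is the derivative of
  \<open>- y * normal_density \<mu> \<sigma> y\<close>, which vanishes at both infinities, so only the value at the endpoint
  \<open>a\<close> remains.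
\<close>

lemma integral_normal_tails:
  fixes \<mu> \<sigma> a :: real
  assumes \<sigma>: "\<sigma> > 0"
  defines "f \<equiv> (\<lambda>y. ((y - \<mu>) * y / \<sigma>\<^sup>2 - 1) * normal_density \<mu> \<sigma> y)"
  shows "integrable lborel f"
    and "(\<integral>y. indicator {a<..} y * f y \<partial>lborel) = a * normal_density \<mu> \<sigma> a"
    and "(\<integral>y. indicator {..<a} y * f y \<partial>lborel) = - a * normal_density \<mu> \<sigma> a"
proof -
  let ?F = "\<lambda>y. - y * normal_density \<mu> \<sigma> y"
  have "integrable lborel (\<lambda>y. normal_density \<mu> \<sigma> y * ((y - \<mu>) * y) / \<sigma>\<^sup>2 - normal_density \<mu> \<sigma> y)"
    using integrable_normal_density_moments[OF \<sigma>] \<sigma> by auto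
  thus int: "integrable lborel f" unfolding f_def by (simp add: algebra_simps)
  have D: "(?F has_vector_derivative f y) (at y)" for y
    using has_derivative_id_times_normal_density[OF \<sigma>, of \<mu> y]
    by (simp add: has_real_derivative_iff_has_vector_derivative f_def)
  have C: "isCont f y" for y
    unfolding f_def normal_density_def using \<sigma> by (auto intro!: continuous_intros)
  have FC: "isCont ?F a"
    unfolding normal_density_def using \<sigma> by (auto intro!: continuous_intros)
  have si: "set_integrable lborel A f" if "A \<in> sets borel" for A
    unfolding set_integrable_def using integrable_mult_indicator[of A lborel f] int that by simp
  have "(LBINT y=ereal a..\<infinity>. f y) = 0 - ?F a"
  proof (rule interval_integral_FTC_integrable)
    show "((?F \<circ> real_of_ereal) \<longlongrightarrow> ?F a) (at_right (ereal a))"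
      unfolding ereal_tendsto_simps using FC by (auto simp: isCont_def intro: tendsto_within_subset)
    show "((?F \<circ> real_of_ereal) \<longlongrightarrow> 0) (at_left \<infinity>)"
      unfolding ereal_tendsto_simps by (rule tendsto_id_times_normal_density[OF \<sigma>])
  qed (use D C si in auto)
  thus "(\<integral>y. indicator {a<..} y * f y \<partial>lborel) = a * normal_density \<mu> \<sigma> a"
    by (simp add: interval_lebesgue_integral_def set_lebesgue_integral_def)
  have "(LBINT y=-\<infinity>..ereal a. f y) = ?F a - 0"
  proof (rule interval_integral_FTC_integrable)
    show "((?F \<circ> real_of_ereal) \<longlongrightarrow> ?F a) (at_left (ereal a))"
      unfolding ereal_tendsto_simps using FC by (auto simp: isCont_def intro: tendsto_within_subset)
    show "((?F \<circ> real_of_ereal) \<longlongrightarrow> 0) (at_right (-\<infinity>))"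
      unfolding ereal_tendsto_simps by (rule tendsto_id_times_normal_density[OF \<sigma>])
  qed (use D C si in auto)
  thus "(\<integral>y. indicator {..<a} y * f y \<partial>lborel) = - a * normal_density \<mu> \<sigma> a"
    by (simp add: interval_lebesgue_integral_def set_lebesgue_integral_def)
qed

text \<open>
  Stein's identity for a function with jumps. Away from \<open>\<plusminus>l\<close> hard thresholding has the indicator of
  \<open>\<bar>y\<bar> > l\<close> as its derivative; each of its two jumps, of height \<open>l\<close>, adds the density there times \<open>l\<close>.
\<close>

lemma stein_hard_threshold:
  assumes \<sigma>: "\<sigma> > 0" and l: "l > 0"
  shows "(\<integral>y. normal_density \<mu> \<sigma> y * ((y - \<mu>) * (if \<bar>y\<bar> < l then 0 else y)) \<partial>lborel) / \<sigma>\<^sup>2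
    = (\<integral>y. normal_density \<mu> \<sigma> y * indicator {y. \<bar>y\<bar> > l} y \<partial>lborel)
      + l * (normal_density \<mu> \<sigma> l + normal_density \<mu> \<sigma> (- l))"
proof -
  let ?n = "normal_density \<mu> \<sigma>"
  define f where "f = (\<lambda>y. ((y - \<mu>) * y / \<sigma>\<^sup>2 - 1) * ?n y)"
  have T: "integrable lborel f"
      "(\<integral>y. indicator {l<..} y * f y \<partial>lborel) = l * ?n l"
      "(\<integral>y. indicator {..<-l} y * f y \<partial>lborel) = l * ?n (- l)"
    using integral_normal_tails(1)[OF \<sigma>, of \<mu>] integral_normal_tails(2)[OF \<sigma>, of l \<mu>]
      integral_normal_tails(3)[OF \<sigma>, of "- l" \<mu>] by (simp_all add: f_def)
  have ind: "integrable lborel (\<lambda>y. indicator A y * f y)" if "A \<in> sets borel" for A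
    using integrable_mult_indicator[OF _ T(1), of A] that by simp
  have ni: "integrable lborel (\<lambda>y. ?n y * indicator {y. \<bar>y\<bar> > l} y)"
    using \<sigma> by (intro integrable_real_mult_indicator) auto
  have "(\<integral>y. ?n y * ((y - \<mu>) * (if \<bar>y\<bar> < l then 0 else y)) \<partial>lborel) / \<sigma>\<^sup>2
      = (\<integral>y. ?n y * ((y - \<mu>) * (if \<bar>y\<bar> < l then 0 else y)) / \<sigma>\<^sup>2 \<partial>lborel)"
    by simp
  also have "\<dots> = (\<integral>y. ?n y * indicator {y. \<bar>y\<bar> > l} y
        + (indicator {l<..} y * f y + indicator {..<-l} y * f y) \<partial>lborel)"
  proof (rule integral_cong_AE)
    show "AE y in lborel. ?n y * ((y - \<mu>) * (if \<bar>y\<bar> < l then 0 else y)) / \<sigma>\<^sup>2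
      = ?n y * indicator {y. \<bar>y\<bar> > l} y + (indicator {l<..} y * f y + indicator {..<-l} y * f y)"
      using AE_lborel_singleton[of l] AE_lborel_singleton[of "- l"]
    proof eventually_elim
      case (elim y)
      \<comment> \<open>At \<open>\<bar>y\<bar> = l\<close> the threshold function keeps \<open>y\<close> while the indicators vanish: a null set.\<close>
      consider "\<bar>y\<bar> < l" | "y > l" | "y < - l" using elim by linarith
      thus ?case using l by cases (auto simp: f_def field_simps)
    qed
  qed (auto simp: f_def)
  also have "\<dots> = (\<integral>y. ?n y * indicator {y. \<bar>y\<bar> > l} y \<partial>lborel)
      + ((\<integral>y. indicator {l<..} y * f y \<partial>lborel) + (\<integral>y. indicator {..<-l} y * f y \<partial>lborel))"
    by (simp only: Bochner_Integration.integral_add[OF ni Bochner_Integration.integrable_add[OF ind ind]]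
        Bochner_Integration.integral_add[OF ind ind] borel_open[OF open_greaterThan] borel_open[OF open_lessThan])
  finally show ?thesis unfolding T by (simp add: algebra_simps)
qed

text \<open>
  Up to the factor \<open>sqrt (2 * pi) * h\<close>, the exponential is a normal density with variance \<open>h\<^sup>2\<close>
  evaluated at \<open>a - y\<close>, so the integral is a convolution of normal densities, in which the variances add.
\<close>

lemma integral_normal_gauss_kernel:
  assumes \<sigma>: "\<sigma> > 0" and h: "h > 0"
  shows "(\<integral>y. normal_density \<mu> \<sigma> y * exp (- (y - a)\<^sup>2 / (2 * h\<^sup>2)) \<partial>lborel)
    = h / sqrt (\<sigma>\<^sup>2 + h\<^sup>2) * exp (- (a - \<mu>)\<^sup>2 / (2 * (\<sigma>\<^sup>2 + h\<^sup>2)))"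
proof -
  let ?g = "\<lambda>y. normal_density 0 h (a - y) * normal_density \<mu> \<sigma> y"
  have "(\<integral>\<^sup>+y. ennreal (?g y) \<partial>lborel) = (\<integral>\<^sup>+y. ennreal (?g (\<mu> + 1 * y)) \<partial>lborel)"
    by (subst nn_integral_real_affine[where t = \<mu> and c = 1]) auto
  also have "\<dots> = (\<integral>\<^sup>+y. ennreal (normal_density 0 h ((a - \<mu>) - y) * normal_density 0 \<sigma> y) \<partial>lborel)"
    by (simp add: normal_density_def algebra_simps)
  also have "\<dots> = ennreal (normal_density 0 (sqrt (h\<^sup>2 + \<sigma>\<^sup>2)) (a - \<mu>))"
    using fun_cong[OF conv_normal_density_zero_mean[OF h \<sigma>]] .
  finally have "(\<integral>y. ?g y \<partial>lborel) = normal_density 0 (sqrt (h\<^sup>2 + \<sigma>\<^sup>2)) (a - \<mu>)"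
    by (subst integral_eq_nn_integral) auto
  moreover have "normal_density \<mu> \<sigma> y * exp (- (y - a)\<^sup>2 / (2 * h\<^sup>2)) = sqrt (2 * pi * h\<^sup>2) * ?g y" for y
    using h by (simp add: normal_density_def power2_commute[of a y])
  ultimately have "(\<integral>y. normal_density \<mu> \<sigma> y * exp (- (y - a)\<^sup>2 / (2 * h\<^sup>2)) \<partial>lborel)
      = sqrt (2 * pi * h\<^sup>2) * normal_density 0 (sqrt (h\<^sup>2 + \<sigma>\<^sup>2)) (a - \<mu>)"
    by (simp only: integral_mult_right_zero)
  also have "\<dots> = h / sqrt (\<sigma>\<^sup>2 + h\<^sup>2) * exp (- (a - \<mu>)\<^sup>2 / (2 * (\<sigma>\<^sup>2 + h\<^sup>2)))"
    using h by (simp add: normal_density_def real_sqrt_mult add.commute)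
  finally show ?thesis .
qed

text \<open>
  The estimator sees the density at \<open>\<plusminus>l\<close> with variance \<open>\<sigma>\<^sup>2 + h\<^sup>2\<close> in place of \<open>\<sigma>\<^sup>2\<close>. The bound on the
  resulting error does not depend on \<open>v\<close>, which later stands for a squared distance from the unknown mean:
  this is what makes the final limits uniform in \<open>x0\<close>.
\<close>

lemma abs_exp_diff_variance_le:
  fixes \<sigma> h v :: real
  assumes \<sigma>: "\<sigma> > 0" and v: "v \<ge> 0"
  shows "\<bar>exp (- v / (2 * (\<sigma>\<^sup>2 + h\<^sup>2))) - exp (- v / (2 * \<sigma>\<^sup>2))\<bar> \<le> h\<^sup>2 / \<sigma>\<^sup>2"
proof -
  define s where "s = v / (2 * (\<sigma>\<^sup>2 + h\<^sup>2))"
  define r where "r = h\<^sup>2 / \<sigma>\<^sup>2"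
  have s0: "s \<ge> 0" and r0: "r \<ge> 0" using v by (auto simp: s_def r_def)
  have pos: "\<sigma>\<^sup>2 + h\<^sup>2 > 0" using \<sigma> by (simp add: add_pos_nonneg)
  \<comment> \<open>The two exponents differ by the factor \<open>1 + r\<close>, and \<open>s * exp (- s) \<le> 1\<close> absorbs the size of \<open>s\<close>.\<close>
  have t: "v / (2 * \<sigma>\<^sup>2) = s + s * r"
    using \<sigma> pos by (simp add: s_def r_def divide_simps) (simp add: algebra_simps)
  have "exp (- s) - exp (- (s + s * r)) = exp (- s) * (1 - exp (- (s * r)))"
    by (simp add: exp_add[symmetric] algebra_simps)
  also have "\<dots> \<le> exp (- s) * (s * r)"
    using exp_ge_add_one_self[of "- (s * r)"] by (intro mult_left_mono) auto
  also have "\<dots> = (exp (- s) * s) * r" by simp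
  also have "\<dots> \<le> 1 * r"
  proof (rule mult_right_mono[OF _ r0])
    have "s \<le> exp s" using exp_ge_add_one_self[of s] by linarith
    thus "exp (- s) * s \<le> 1" by (simp add: exp_minus field_simps)
  qed
  finally have "exp (- s) - exp (- (s + s * r)) \<le> r" by simp
  moreover have "exp (- (s + s * r)) \<le> exp (- s)" using s0 r0 by simp
  ultimately have "\<bar>exp (- s) - exp (- (s + s * r))\<bar> \<le> r" using r0 by linarith
  thus ?thesis unfolding t[symmetric] unfolding s_def r_def by (simp only: minus_divide_left)
qed

section \<open>The estimator in one coordinate\<close>

definition df_hat_coord :: "real \<Rightarrow> real \<Rightarrow> real \<Rightarrow> real \<Rightarrow> real" where
  "df_hat_coord \<sigma> l h y = indicator {y. \<bar>y\<bar> > l} y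
     + l * sqrt (\<sigma>\<^sup>2 + h\<^sup>2) / (sqrt (2 * pi) * \<sigma> * h) *
       (exp (- (y + l)\<^sup>2 / (2 * h\<^sup>2)) + exp (- (y - l)\<^sup>2 / (2 * h\<^sup>2)))"

lemma df_hat_HT_eq_sum: "df_hat_HT P \<sigma> y l h = (\<Sum>i<P. df_hat_coord \<sigma> l h (y i))"
proof -
  have "real (card {i. i < P \<and> \<bar>y i\<bar> > l}) = (\<Sum>i<P. indicator {y. \<bar>y\<bar> > l} (y i))"
    by (simp add: indicator_def sum.If_cases Int_def)
  thus ?thesis
    unfolding df_hat_HT_def df_hat_coord_def sum.distrib sum_distrib_left[symmetric] by (rule arg_cong)
qed

lemma borel_measurable_df_hat_coord[measurable]: "df_hat_coord \<sigma> l h \<in> borel_measurable borel"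
  unfolding df_hat_coord_def by measurable

lemma df_hat_coord_bounds:
  assumes "\<sigma> > 0" "l > 0" "h > 0"
  shows "0 \<le> df_hat_coord \<sigma> l h y"
    and "df_hat_coord \<sigma> l h y \<le> 1 + 2 * (l * sqrt (\<sigma>\<^sup>2 + h\<^sup>2) / (sqrt (2 * pi) * \<sigma>)) * inverse h"
proof -
  let ?c = "l * sqrt (\<sigma>\<^sup>2 + h\<^sup>2) / (sqrt (2 * pi) * \<sigma> * h)"
  let ?e = "exp (- (y + l)\<^sup>2 / (2 * h\<^sup>2)) + exp (- (y - l)\<^sup>2 / (2 * h\<^sup>2))"
  have c: "0 \<le> ?c" using assms by simp
  have "exp (- (y + l)\<^sup>2 / (2 * h\<^sup>2)) \<le> 1" "exp (- (y - l)\<^sup>2 / (2 * h\<^sup>2)) \<le> 1"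
    by (simp_all add: divide_nonpos_nonneg)
  hence e: "?e \<le> 2" by linarith
  show "0 \<le> df_hat_coord \<sigma> l h y"
    unfolding df_hat_coord_def using c by (intro add_nonneg_nonneg mult_nonneg_nonneg) auto
  have "df_hat_coord \<sigma> l h y \<le> 1 + ?c * 2"
    unfolding df_hat_coord_def by (intro add_mono mult_left_mono e c) (simp add: indicator_def)
  thus "df_hat_coord \<sigma> l h y \<le> 1 + 2 * (l * sqrt (\<sigma>\<^sup>2 + h\<^sup>2) / (sqrt (2 * pi) * \<sigma>)) * inverse h"
    by (simp add: field_simps)
qed

text \<open>
  The factor \<open>sqrt (\<sigma>\<^sup>2 + h\<^sup>2)\<close> in the estimator cancels the normalisation of the smoothed density
  exactly, so that smoothing affects the exponents only.
\<close>

lemma (in prob_space) expectation_df_hat_coord: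
  assumes \<sigma>: "\<sigma> > 0" and l: "l > 0" and h: "h > 0"
    and Y: "distributed M lborel Y (normal_density \<mu> \<sigma>)"
  shows "expectation (\<lambda>\<omega>. df_hat_coord \<sigma> l h (Y \<omega>))
    = (\<integral>y. normal_density \<mu> \<sigma> y * indicator {y. \<bar>y\<bar> > l} y \<partial>lborel)
      + l / (sqrt (2 * pi) * \<sigma>) *
        (exp (- (l + \<mu>)\<^sup>2 / (2 * (\<sigma>\<^sup>2 + h\<^sup>2))) + exp (- (l - \<mu>)\<^sup>2 / (2 * (\<sigma>\<^sup>2 + h\<^sup>2))))"
proof -
  let ?n = "normal_density \<mu> \<sigma>"
  let ?c = "l * sqrt (\<sigma>\<^sup>2 + h\<^sup>2) / (sqrt (2 * pi) * \<sigma> * h)"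
  have int: "integrable lborel (\<lambda>y. ?n y * exp (- (y - a)\<^sup>2 / (2 * h\<^sup>2)))" for a
    by (rule Bochner_Integration.integrable_bound[OF integrable_normal_density[OF \<sigma>, of \<mu>]])
       (auto simp: divide_nonpos_nonneg intro!: mult_left_le)
  have ind: "integrable lborel (\<lambda>y. ?n y * indicator {y. \<bar>y\<bar> > l} y)"
    using \<sigma> by (intro integrable_real_mult_indicator) auto
  have pos: "sqrt (\<sigma>\<^sup>2 + h\<^sup>2) > 0" using \<sigma> by (simp add: add_pos_nonneg)
  have "expectation (\<lambda>\<omega>. df_hat_coord \<sigma> l h (Y \<omega>)) = (\<integral>y. ?n y * df_hat_coord \<sigma> l h y \<partial>lborel)"
    using Y by (subst distributed_integral[OF Y]) auto
  also have "\<dots> = (\<integral>y. ?n y * indicator {y. \<bar>y\<bar> > l} y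
      + ?c * (?n y * exp (- (y - (- l))\<^sup>2 / (2 * h\<^sup>2)) + ?n y * exp (- (y - l)\<^sup>2 / (2 * h\<^sup>2))) \<partial>lborel)"
    by (simp add: df_hat_coord_def algebra_simps)
  also have "\<dots> = (\<integral>y. ?n y * indicator {y. \<bar>y\<bar> > l} y \<partial>lborel)
      + ?c * ((\<integral>y. ?n y * exp (- (y - (- l))\<^sup>2 / (2 * h\<^sup>2)) \<partial>lborel)
            + (\<integral>y. ?n y * exp (- (y - l)\<^sup>2 / (2 * h\<^sup>2)) \<partial>lborel))"
    using int[of "- l"] int[of l] ind by simp
  also have "\<dots> = (\<integral>y. ?n y * indicator {y. \<bar>y\<bar> > l} y \<partial>lborel)
      + ?c * (h / sqrt (\<sigma>\<^sup>2 + h\<^sup>2)) *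
        (exp (- (- l - \<mu>)\<^sup>2 / (2 * (\<sigma>\<^sup>2 + h\<^sup>2))) + exp (- (l - \<mu>)\<^sup>2 / (2 * (\<sigma>\<^sup>2 + h\<^sup>2))))"
    unfolding integral_normal_gauss_kernel[OF \<sigma> h] by (simp only: distrib_left mult.assoc)
  also have "?c * (h / sqrt (\<sigma>\<^sup>2 + h\<^sup>2)) = l / (sqrt (2 * pi) * \<sigma>)"
    using h pos \<sigma> by simp
  also have "(- l - \<mu>)\<^sup>2 = (l + \<mu>)\<^sup>2" by (simp add: power2_eq_square algebra_simps)
  finally show ?thesis .
qed

lemma (in prob_space) covariance_hard_threshold:
  assumes \<sigma>: "\<sigma> > 0" and l: "l > 0"
    and Y: "distributed M lborel Y (normal_density \<mu> \<sigma>)"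
  shows "covariance M Y (\<lambda>\<omega>. if \<bar>Y \<omega>\<bar> < l then 0 else Y \<omega>) / \<sigma>\<^sup>2
    = (\<integral>y. normal_density \<mu> \<sigma> y * indicator {y. \<bar>y\<bar> > l} y \<partial>lborel)
      + l / (sqrt (2 * pi) * \<sigma>) *
        (exp (- (l + \<mu>)\<^sup>2 / (2 * \<sigma>\<^sup>2)) + exp (- (l - \<mu>)\<^sup>2 / (2 * \<sigma>\<^sup>2)))"
proof -
  let ?n = "normal_density \<mu> \<sigma>"
  let ?t = "\<lambda>y. if \<bar>y\<bar> < l then 0 else y :: real"
  have [measurable]: "?t \<in> borel_measurable borel" by measurable
  have Ym[measurable]: "Y \<in> borel_measurable M"
    using Y by (simp add: distributed_def)
  have EY: "expectation Y = \<mu>"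
    using distributed_integral[OF Y, of "\<lambda>y. y"] normal_moment_nz_1[OF \<sigma>, of \<mu>]
    by (simp add: has_bochner_integral_iff)
  have intd: "integrable M (\<lambda>\<omega>. Y \<omega> - \<mu>)"
    using distributed_integrable[OF Y, of "\<lambda>y. y - \<mu>"] integrable_normal_density_moments(2)[OF \<sigma>] by simp
  have Ed: "expectation (\<lambda>\<omega>. Y \<omega> - \<mu>) = 0"
  proof -
    have "integrable M Y"
      using distributed_integrable[OF Y, of "\<lambda>y. y"] integrable_normal_density_moments(3)[OF \<sigma>] by simp
    thus ?thesis using EY by (simp add: prob_space)
  qed
  have "integrable lborel (\<lambda>y. ?n y * ((y - \<mu>) * ?t y))"
    by (rule Bochner_Integration.integrable_bound[OF integrable_normal_density_moments(1)[OF \<sigma>, of \<mu>]])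
       (auto simp: abs_mult)
  hence intt: "integrable M (\<lambda>\<omega>. (Y \<omega> - \<mu>) * ?t (Y \<omega>))"
    by (subst distributed_integrable[OF Y, symmetric]) auto
  have "covariance M Y (\<lambda>\<omega>. ?t (Y \<omega>))
      = expectation (\<lambda>\<omega>. (Y \<omega> - \<mu>) * ?t (Y \<omega>) - (Y \<omega> - \<mu>) * expectation (\<lambda>\<omega>. ?t (Y \<omega>)))"
    unfolding covariance_def EY by (simp only: right_diff_distrib)
  also have "\<dots> = expectation (\<lambda>\<omega>. (Y \<omega> - \<mu>) * ?t (Y \<omega>))
      - expectation (\<lambda>\<omega>. (Y \<omega> - \<mu>) * expectation (\<lambda>\<omega>. ?t (Y \<omega>)))"
    by (rule Bochner_Integration.integral_diff[OF intt integrable_mult_left[OF intd]])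
  also have "\<dots> = expectation (\<lambda>\<omega>. (Y \<omega> - \<mu>) * ?t (Y \<omega>))"
    unfolding integral_mult_left_zero Ed by simp
  also have "\<dots> = (\<integral>y. ?n y * ((y - \<mu>) * ?t y) \<partial>lborel)"
    by (subst distributed_integral[OF Y]) auto
  finally have "covariance M Y (\<lambda>\<omega>. ?t (Y \<omega>)) / \<sigma>\<^sup>2
    = (\<integral>y. ?n y * indicator {y. \<bar>y\<bar> > l} y \<partial>lborel) + l * (?n l + ?n (- l))"
    using stein_hard_threshold[OF \<sigma> l] by simp
  moreover have "(- l - \<mu>)\<^sup>2 = (l + \<mu>)\<^sup>2" by (simp add: power2_eq_square algebra_simps)
  ultimately show ?thesis
    using \<sigma> by (simp add: normal_density_def real_sqrt_mult field_simps)
qed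

text \<open>
  The counting terms cancel exactly; only the change of variance in the two jump terms is left.
\<close>

lemma (in prob_space) bias_df_hat_coord:
  assumes \<sigma>: "\<sigma> > 0" and l: "l > 0" and h: "h > 0"
    and Y: "distributed M lborel Y (normal_density \<mu> \<sigma>)"
  shows "\<bar>expectation (\<lambda>\<omega>. df_hat_coord \<sigma> l h (Y \<omega>))
      - covariance M Y (\<lambda>\<omega>. if \<bar>Y \<omega>\<bar> < l then 0 else Y \<omega>) / \<sigma>\<^sup>2\<bar>
    \<le> l / (sqrt (2 * pi) * \<sigma>) * (2 * (h\<^sup>2 / \<sigma>\<^sup>2))"
proof -
  let ?d = "\<lambda>v. exp (- v / (2 * (\<sigma>\<^sup>2 + h\<^sup>2))) - exp (- v / (2 * \<sigma>\<^sup>2))"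
  have rearrange: "(p + k * (a + b)) - (p + k * (a' + b')) = k * ((a - a') + (b - b'))"
    for p k a a' b b' :: real by (simp add: algebra_simps)
  have k: "0 \<le> l / (sqrt (2 * pi) * \<sigma>)" using \<sigma> l by simp
  have eq: "expectation (\<lambda>\<omega>. df_hat_coord \<sigma> l h (Y \<omega>))
      - covariance M Y (\<lambda>\<omega>. if \<bar>Y \<omega>\<bar> < l then 0 else Y \<omega>) / \<sigma>\<^sup>2
      = l / (sqrt (2 * pi) * \<sigma>) * (?d ((l + \<mu>)\<^sup>2) + ?d ((l - \<mu>)\<^sup>2))"
    unfolding expectation_df_hat_coord[OF \<sigma> l h Y] covariance_hard_threshold[OF \<sigma> l Y]
    by (rule rearrange)
  have "\<bar>expectation (\<lambda>\<omega>. df_hat_coord \<sigma> l h (Y \<omega>))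
      - covariance M Y (\<lambda>\<omega>. if \<bar>Y \<omega>\<bar> < l then 0 else Y \<omega>) / \<sigma>\<^sup>2\<bar>
      = l / (sqrt (2 * pi) * \<sigma>) * \<bar>?d ((l + \<mu>)\<^sup>2) + ?d ((l - \<mu>)\<^sup>2)\<bar>"
    unfolding eq abs_mult abs_of_nonneg[OF k] ..
  also have "\<dots> \<le> l / (sqrt (2 * pi) * \<sigma>) * (2 * (h\<^sup>2 / \<sigma>\<^sup>2))"
  proof (rule mult_left_mono)
    have "\<bar>?d ((l + \<mu>)\<^sup>2) + ?d ((l - \<mu>)\<^sup>2)\<bar> \<le> \<bar>?d ((l + \<mu>)\<^sup>2)\<bar> + \<bar>?d ((l - \<mu>)\<^sup>2)\<bar>"
      by (rule abs_triangle_ineq)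
    also have "\<dots> \<le> h\<^sup>2 / \<sigma>\<^sup>2 + h\<^sup>2 / \<sigma>\<^sup>2"
      by (rule add_mono; rule abs_exp_diff_variance_le[OF \<sigma> zero_le_power2])
    also have "\<dots> = 2 * (h\<^sup>2 / \<sigma>\<^sup>2)"
      by (rule mult_2[symmetric])
    finally show "\<bar>?d ((l + \<mu>)\<^sup>2) + ?d ((l - \<mu>)\<^sup>2)\<bar> \<le> 2 * (h\<^sup>2 / \<sigma>\<^sup>2)" .
  qed (rule k)
  finally show ?thesis .
qed

text \<open>
  For small \<open>h\<close> the estimator is of order \<open>1 / h\<close> at worst, but its mean stays bounded. Hence the second moment, at
  most the product of the supremum and the mean, is of order \<open>1 / h\<close> and not \<open>1 / h\<^sup>2\<close>; this is why
  \<open>1 / (P * h) \<longlonglongrightarrow> 0\<close> suffices for the variance.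
\<close>

lemma (in prob_space) second_moment_df_hat_coord:
  assumes \<sigma>: "\<sigma> > 0" and l: "l > 0" and h: "h > 0"
    and Y: "distributed M lborel Y (normal_density \<mu> \<sigma>)"
  shows "integrable M (\<lambda>\<omega>. (df_hat_coord \<sigma> l h (Y \<omega>))\<^sup>2)"
    and "expectation (\<lambda>\<omega>. (df_hat_coord \<sigma> l h (Y \<omega>))\<^sup>2)
      \<le> (1 + 2 * (l * sqrt (\<sigma>\<^sup>2 + h\<^sup>2) / (sqrt (2 * pi) * \<sigma>)) * inverse h)
        * (1 + 2 * (l / (sqrt (2 * pi) * \<sigma>)))"
proof -
  define B where "B = 1 + 2 * (l * sqrt (\<sigma>\<^sup>2 + h\<^sup>2) / (sqrt (2 * pi) * \<sigma>)) * inverse h"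
  let ?g = "\<lambda>\<omega>. df_hat_coord \<sigma> l h (Y \<omega>)"
  note b = df_hat_coord_bounds[OF \<sigma> l h, folded B_def]
  have B0: "0 \<le> B" using b[of 0] by linarith
  have [measurable]: "Y \<in> borel_measurable M"
    using Y by (simp add: distributed_def)
  have i1: "integrable M ?g"
    by (rule integrable_const_bound[of _ B]) (use b in auto)
  have sq: "(?g \<omega>)\<^sup>2 \<le> B * ?g \<omega>" for \<omega>
    unfolding power2_eq_square using b by (intro mult_right_mono) auto
  show i2: "integrable M (\<lambda>\<omega>. (?g \<omega>)\<^sup>2)"
    by (rule integrable_const_bound[of _ "B\<^sup>2"]) (use b in \<open>auto intro!: power_mono\<close>)
  have "expectation (\<lambda>\<omega>. (?g \<omega>)\<^sup>2) \<le> expectation (\<lambda>\<omega>. B * ?g \<omega>)"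
    using i1 i2 sq by (intro integral_mono) auto
  also have "\<dots> = B * expectation ?g" by simp
  also have "\<dots> \<le> B * (1 + 2 * (l / (sqrt (2 * pi) * \<sigma>)))"
  proof (rule mult_left_mono[OF _ B0])
    have "(\<integral>y. normal_density \<mu> \<sigma> y * indicator {y. \<bar>y\<bar> > l} y \<partial>lborel) \<le> (\<integral>y. normal_density \<mu> \<sigma> y \<partial>lborel)"
      using \<sigma> by (intro integral_mono integrable_real_mult_indicator) (auto simp: indicator_def)
    moreover have "exp (- (l + \<mu>)\<^sup>2 / (2 * (\<sigma>\<^sup>2 + h\<^sup>2))) + exp (- (l - \<mu>)\<^sup>2 / (2 * (\<sigma>\<^sup>2 + h\<^sup>2))) \<le> 1 + 1"
      by (intro add_mono) (simp_all add: divide_nonpos_nonneg)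
    hence "l / (sqrt (2 * pi) * \<sigma>) *
        (exp (- (l + \<mu>)\<^sup>2 / (2 * (\<sigma>\<^sup>2 + h\<^sup>2))) + exp (- (l - \<mu>)\<^sup>2 / (2 * (\<sigma>\<^sup>2 + h\<^sup>2))))
        \<le> l / (sqrt (2 * pi) * \<sigma>) * (1 + 1)"
      using \<sigma> l by (intro mult_left_mono) auto
    ultimately have "expectation ?g \<le> 1 + l / (sqrt (2 * pi) * \<sigma>) * (1 + 1)"
      unfolding expectation_df_hat_coord[OF \<sigma> l h Y] integral_normal_density[OF \<sigma>] by (rule add_mono)
    thus "expectation ?g \<le> 1 + 2 * (l / (sqrt (2 * pi) * \<sigma>))" by (simp add: mult.commute)
  qed
  finally show "expectation (\<lambda>\<omega>. (?g \<omega>)\<^sup>2) \<le> B * (1 + 2 * (l / (sqrt (2 * pi) * \<sigma>)))" .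
qed

section \<open>Averaging over the coordinates\<close>

lemma df_HT_eq_sum:
  "df_HT M W P \<sigma> x l = (\<Sum>i<P. covariance M (\<lambda>\<omega>. x i + W \<omega> i)
      (\<lambda>\<omega>. if \<bar>x i + W \<omega> i\<bar> < l then 0 else x i + W \<omega> i) / \<sigma>\<^sup>2)"
  by (simp add: df_HT_def HT_def Let_def)

text \<open>
  The bias of the average is at most the coordinatewise bias. Its variance gains a factor
  \<open>1 / P\<close> from independence.
\<close>

lemma (in prob_space) mean_df_hat_HT:
  fixes \<sigma> l h :: real and x :: "nat \<Rightarrow> real"
  assumes \<sigma>: "\<sigma> > 0" and l: "l > 0" and h: "h > 0" and P: "P \<ge> 1"
    and W: "isotropic_normal M P \<sigma> W"
  defines "Z \<equiv> \<lambda>\<omega>. 1 / real P * df_hat_HT P \<sigma> (\<lambda>i. x i + W \<omega> i) l h"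
  shows "integrable M (\<lambda>\<omega>. (Z \<omega>)\<^sup>2)"
    and "\<bar>expectation Z - 1 / real P * df_HT M W P \<sigma> x l\<bar>
      \<le> l / (sqrt (2 * pi) * \<sigma>) * (2 * (h\<^sup>2 / \<sigma>\<^sup>2))"
    and "variance Z \<le>
      (inverse (real P) + 2 * (l * sqrt (\<sigma>\<^sup>2 + h\<^sup>2) / (sqrt (2 * pi) * \<sigma>)) * (inverse (real P) * inverse h))
        * (1 + 2 * (l / (sqrt (2 * pi) * \<sigma>)))"
proof -
  define g where "g = (\<lambda>i \<omega>. df_hat_coord \<sigma> l h (x i + W \<omega> i))"
  define C where "C = (1 + 2 * (l * sqrt (\<sigma>\<^sup>2 + h\<^sup>2) / (sqrt (2 * pi) * \<sigma>)) * inverse h)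
        * (1 + 2 * (l / (sqrt (2 * pi) * \<sigma>)))"
  note coord = isotropic_normal_coordinates[OF prob_space_axioms \<sigma> W]
  have Y: "distributed M lborel (\<lambda>\<omega>. x i + W \<omega> i) (normal_density (x i) \<sigma>)" if "i < P" for i
    using normal_density_affine[OF coord(1)[OF that] \<sigma>, of 1 "x i"] by simp
  have g2: "integrable M (\<lambda>\<omega>. (g i \<omega>)\<^sup>2)" and Eg2: "expectation (\<lambda>\<omega>. (g i \<omega>)\<^sup>2) \<le> C"
    if "i < P" for i
    using second_moment_df_hat_coord[OF \<sigma> l h Y[OF that]] by (simp_all add: g_def C_def)
  have gm: "g i \<in> borel_measurable M" if "i < P" for i
  proof -
    have "(\<lambda>\<omega>. x i + W \<omega> i) \<in> borel_measurable M"
      using Y[OF that] by (simp add: distributed_def)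
    from measurable_compose[OF this borel_measurable_df_hat_coord] show ?thesis by (simp add: g_def)
  qed
  have g1: "integrable M (g i)" if "i < P" for i
    using gm[OF that] g2[OF that] by (rule square_integrable_imp_integrable)
  have ind: "indep_vars (\<lambda>_. borel) g {..<P}"
    unfolding g_def by (rule indep_vars_compose2[OF coord(2)]) measurable
  have Z: "Z = (\<lambda>\<omega>. 1 / real P * (\<Sum>i<P. g i \<omega>))"
    by (simp add: Z_def g_def df_hat_HT_eq_sum)
  have VS: "variance (\<lambda>\<omega>. \<Sum>i<P. g i \<omega>) = (\<Sum>i<P. variance (g i))"
    and S2: "integrable M (\<lambda>\<omega>. (\<Sum>i<P. g i \<omega>)\<^sup>2)"
    using variance_sum_indep[OF _ ind] g2 by auto
  show "integrable M (\<lambda>\<omega>. (Z \<omega>)\<^sup>2)"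
    unfolding Z power_mult_distrib by (rule integrable_mult_right[OF S2])
  have EZ: "expectation Z = 1 / real P * (\<Sum>i<P. expectation (g i))"
    unfolding Z using g1 by simp
  let ?cov = "\<lambda>i. covariance M (\<lambda>\<omega>. x i + W \<omega> i)
      (\<lambda>\<omega>. if \<bar>x i + W \<omega> i\<bar> < l then 0 else x i + W \<omega> i) / \<sigma>\<^sup>2"
  let ?b = "l / (sqrt (2 * pi) * \<sigma>) * (2 * (h\<^sup>2 / \<sigma>\<^sup>2))"
  have "\<bar>expectation Z - 1 / real P * df_HT M W P \<sigma> x l\<bar>
      = 1 / real P * \<bar>\<Sum>i<P. expectation (g i) - ?cov i\<bar>"
    unfolding EZ df_HT_eq_sum right_diff_distrib[symmetric] sum_subtractf[symmetric] abs_mult by simp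
  also have "\<dots> \<le> 1 / real P * (\<Sum>i<P. ?b)"
  proof (rule mult_left_mono)
    show "\<bar>\<Sum>i<P. expectation (g i) - ?cov i\<bar> \<le> (\<Sum>i<P. ?b)"
      unfolding g_def by (rule order_trans[OF sum_abs sum_mono]) (rule bias_df_hat_coord[OF \<sigma> l h Y], simp)
  qed simp
  also have "\<dots> = ?b" using P by simp
  finally show "\<bar>expectation Z - 1 / real P * df_HT M W P \<sigma> x l\<bar> \<le> ?b" .
  have vg: "variance (g i) \<le> C" if "i < P" for i
    unfolding variance_eq[OF g1[OF that] g2[OF that]] using Eg2[OF that]
    by (meson diff_left_mono diff_zero order_trans zero_le_power2 diff_le_eq le_add_same_cancel1)
  have "variance Z = expectation (\<lambda>\<omega>. (1 / real P)\<^sup>2 * ((\<Sum>i<P. g i \<omega>) - expectation (\<lambda>\<omega>. \<Sum>i<P. g i \<omega>))\<^sup>2)"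
    unfolding Z integral_mult_right_zero right_diff_distrib[symmetric] power_mult_distrib ..
  also have "\<dots> = (1 / real P)\<^sup>2 * variance (\<lambda>\<omega>. \<Sum>i<P. g i \<omega>)"
    by (rule integral_mult_right_zero)
  also have "\<dots> \<le> (1 / real P)\<^sup>2 * (\<Sum>i<P. C)"
    unfolding VS using vg by (intro mult_left_mono sum_mono) auto
  also have "\<dots> = inverse (real P) * C"
    using P by (simp add: power2_eq_square field_simps)
  also have "\<dots> = (inverse (real P) + 2 * (l * sqrt (\<sigma>\<^sup>2 + h\<^sup>2) / (sqrt (2 * pi) * \<sigma>)) * (inverse (real P) * inverse h))
        * (1 + 2 * (l / (sqrt (2 * pi) * \<sigma>)))"
    unfolding C_def by (simp only: distrib_left distrib_right mult.assoc mult.left_commute mult_1_right mult_1_left)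
  finally show "variance Z \<le> \<dots>" .
qed

text \<open>
  Once the bias is below \<open>\<epsilon> / 2\<close>, a deviation by \<open>\<epsilon>\<close> from \<open>d\<close> forces a deviation by \<open>\<epsilon> / 2\<close> from the
  mean, which Chebyshev's inequality controls.
\<close>

lemma plim_const_0_if_mean_and_variance:
  assumes "\<And>n. n \<ge> 1 \<Longrightarrow> prob_space (M n)"
    and "\<And>n. n \<ge> 1 \<Longrightarrow> Z n \<in> borel_measurable (M n)"
    and "\<And>n. n \<ge> 1 \<Longrightarrow> integrable (M n) (\<lambda>\<omega>. (Z n \<omega>)\<^sup>2)"
    and bias: "(\<lambda>n. prob_space.expectation (M n) (Z n) - d n) \<longlonglongrightarrow> 0"
    and var: "(\<lambda>n. prob_space.variance (M n) (Z n)) \<longlonglongrightarrow> 0"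
  shows "plim_const M (\<lambda>n \<omega>. Z n \<omega> - d n) 0"
  unfolding plim_const_def
proof (intro allI impI)
  fix \<epsilon> :: real assume \<epsilon>: "\<epsilon> > 0"
  let ?E = "\<lambda>n. prob_space.expectation (M n) (Z n)"
  let ?V = "\<lambda>n. prob_space.variance (M n) (Z n)"
  have "eventually (\<lambda>n. \<bar>?E n - d n\<bar> < \<epsilon> / 2) sequentially"
    using tendstoD[OF bias, of "\<epsilon> / 2"] \<epsilon> by (simp add: dist_real_def)
  hence le: "eventually (\<lambda>n. measure (M n) {\<omega> \<in> space (M n). \<bar>Z n \<omega> - d n - 0\<bar> > \<epsilon>} \<le> ?V n / (\<epsilon> / 2)\<^sup>2) sequentially"
    using eventually_ge_at_top[of 1]
  proof eventually_elim
    case (elim n)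
    interpret prob_space "M n" using assms(1) elim by simp
    have [measurable]: "Z n \<in> borel_measurable (M n)" using assms(2) elim by simp
    have "prob {\<omega> \<in> space (M n). \<bar>Z n \<omega> - d n - 0\<bar> > \<epsilon>}
        \<le> prob {\<omega> \<in> space (M n). \<bar>Z n \<omega> - ?E n\<bar> \<ge> \<epsilon> / 2}"
    proof (rule finite_measure_mono)
      show "{\<omega> \<in> space (M n). \<bar>Z n \<omega> - d n - 0\<bar> > \<epsilon>} \<subseteq> {\<omega> \<in> space (M n). \<bar>Z n \<omega> - ?E n\<bar> \<ge> \<epsilon> / 2}"
      proof (intro Collect_mono impI)
        fix \<omega> assume *: "\<omega> \<in> space (M n) \<and> \<bar>Z n \<omega> - d n - 0\<bar> > \<epsilon>"
        have "\<bar>Z n \<omega> - d n\<bar> \<le> \<bar>Z n \<omega> - ?E n\<bar> + \<bar>?E n - d n\<bar>" by linarith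
        with elim(1) * show "\<omega> \<in> space (M n) \<and> \<bar>Z n \<omega> - ?E n\<bar> \<ge> \<epsilon> / 2" by simp
      qed
    qed measurable
    also have "\<dots> \<le> ?V n / (\<epsilon> / 2)\<^sup>2"
      using assms(2,3) elim \<epsilon> by (intro Chebyshev_inequality) auto
    finally show ?case .
  qed
  have lim: "(\<lambda>n. ?V n / (\<epsilon> / 2)\<^sup>2) \<longlonglongrightarrow> 0"
    using tendsto_divide[OF var tendsto_const, of "(\<epsilon> / 2)\<^sup>2"] \<epsilon> by simp
  show "(\<lambda>n. measure (M n) {\<omega> \<in> space (M n). \<bar>Z n \<omega> - d n - 0\<bar> > \<epsilon>}) \<longlonglongrightarrow> 0"
    by (rule tendsto_sandwich[OF _ le tendsto_const lim]) simp
qed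

theorem theorem1:
  fixes \<sigma> l :: real
    and h :: "nat \<Rightarrow> real"
    and x0 :: "nat \<Rightarrow> nat \<Rightarrow> real"
    and M :: "nat \<Rightarrow> 'a measure"
    and W Y :: "nat \<Rightarrow> 'a \<Rightarrow> nat \<Rightarrow> real"
  assumes "\<sigma> > 0" and "l > 0"
    and "\<And>P. P \<ge> 1 \<Longrightarrow> prob_space (M P)"
    and "\<And>P. P \<ge> 1 \<Longrightarrow> isotropic_normal (M P) P \<sigma> (W P)"
    and "\<And>P \<omega> i. Y P \<omega> i = x0 P i + W P \<omega> i"
    and "\<And>P. P \<ge> 1 \<Longrightarrow> h P > 0"
    and "h \<longlonglongrightarrow> 0"
    and "(\<lambda>P. inverse (real P) * inverse (h P)) \<longlonglongrightarrow> 0"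
  shows "plim_const M
           (\<lambda>P \<omega>. 1 / real P * (df_hat_HT P \<sigma> (Y P \<omega>) l (h P) - df_HT (M P) (W P) P \<sigma> (x0 P) l)) 0
       \<and> ((\<lambda>P. prob_space.expectation (M P) (\<lambda>\<omega>. 1 / real P * df_hat_HT P \<sigma> (Y P \<omega>) l (h P))
               - 1 / real P * df_HT (M P) (W P) P \<sigma> (x0 P) l) \<longlonglongrightarrow> 0)
       \<and> (\<forall>L. ((\<lambda>P. prob_space.expectation (M P)
                      (\<lambda>\<omega>. 1 / real P * df_hat_HT P \<sigma> (Y P \<omega>) l (h P))) \<longlonglongrightarrow> L)
              \<longleftrightarrow> ((\<lambda>P. 1 / real P * df_HT (M P) (W P) P \<sigma> (x0 P) l) \<longlonglongrightarrow> L))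
       \<and> ((\<lambda>P. prob_space.variance (M P)
                 (\<lambda>\<omega>. 1 / real P * df_hat_HT P \<sigma> (Y P \<omega>) l (h P))) \<longlonglongrightarrow> 0)"
proof -
  define Z where "Z = (\<lambda>P \<omega>. 1 / real P * df_hat_HT P \<sigma> (Y P \<omega>) l (h P))"
  define d where "d = (\<lambda>P. 1 / real P * df_HT (M P) (W P) P \<sigma> (x0 P) l)"
  have Yeq: "Y P \<omega> = (\<lambda>i. x0 P i + W P \<omega> i)" for P \<omega> using assms(5) by auto
  have mean: "\<bar>prob_space.expectation (M P) (Z P) - d P\<bar>
      \<le> l / (sqrt (2 * pi) * \<sigma>) * (2 * ((h P)\<^sup>2 / \<sigma>\<^sup>2))"
    and Z2: "integrable (M P) (\<lambda>\<omega>. (Z P \<omega>)\<^sup>2)"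
    and var: "prob_space.variance (M P) (Z P) \<le>
      (inverse (real P) + 2 * (l * sqrt (\<sigma>\<^sup>2 + (h P)\<^sup>2) / (sqrt (2 * pi) * \<sigma>)) * (inverse (real P) * inverse (h P)))
        * (1 + 2 * (l / (sqrt (2 * pi) * \<sigma>)))" if "P \<ge> 1" for P
    using prob_space.mean_df_hat_HT[OF assms(3)[OF that] assms(1,2) assms(6)[OF that] that assms(4)[OF that], of "x0 P"]
    by (simp_all only: Z_def d_def Yeq)
  have Zm: "Z P \<in> borel_measurable (M P)" if "P \<ge> 1" for P
  proof -
    have [measurable]: "(\<lambda>\<omega>. W P \<omega> i) \<in> borel_measurable (M P)" if "i < P" for i
      using isotropic_normal_coordinates(1)[OF assms(3)[OF \<open>P \<ge> 1\<close>] assms(1) assms(4)[OF \<open>P \<ge> 1\<close>] that]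
      by (simp add: distributed_def)
    show ?thesis unfolding Z_def Yeq df_hat_HT_eq_sum by measurable
  qed
  have "(\<lambda>P. l / (sqrt (2 * pi) * \<sigma>) * (2 * ((h P)\<^sup>2 / \<sigma>\<^sup>2))) \<longlonglongrightarrow>
      l / (sqrt (2 * pi) * \<sigma>) * (2 * (0\<^sup>2 / \<sigma>\<^sup>2))"
    using assms(1,7) by (intro tendsto_intros) auto
  hence bound0: "(\<lambda>P. l / (sqrt (2 * pi) * \<sigma>) * (2 * ((h P)\<^sup>2 / \<sigma>\<^sup>2))) \<longlonglongrightarrow> 0"
    by (simp only: power_zero_numeral div_0 mult_zero_right)
  have bias: "(\<lambda>P. prob_space.expectation (M P) (Z P) - d P) \<longlonglongrightarrow> 0"
  proof (rule Lim_null_comparison[OF eventually_sequentiallyI[of 1] bound0])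
    show "norm (prob_space.expectation (M P) (Z P) - d P)
        \<le> l / (sqrt (2 * pi) * \<sigma>) * (2 * ((h P)\<^sup>2 / \<sigma>\<^sup>2))" if "P \<ge> 1" for P
      unfolding real_norm_def by (rule mean[OF that])
  qed
  have "(\<lambda>P. (inverse (real P) + 2 * (l * sqrt (\<sigma>\<^sup>2 + (h P)\<^sup>2) / (sqrt (2 * pi) * \<sigma>)) * (inverse (real P) * inverse (h P)))
        * (1 + 2 * (l / (sqrt (2 * pi) * \<sigma>)))) \<longlonglongrightarrow>
      (0 + 2 * (l * sqrt (\<sigma>\<^sup>2 + 0\<^sup>2) / (sqrt (2 * pi) * \<sigma>)) * 0) * (1 + 2 * (l / (sqrt (2 * pi) * \<sigma>)))"
    using assms(1) by (intro tendsto_intros assms(7,8) lim_inverse_n) auto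
  hence bound1: "(\<lambda>P. (inverse (real P) + 2 * (l * sqrt (\<sigma>\<^sup>2 + (h P)\<^sup>2) / (sqrt (2 * pi) * \<sigma>)) * (inverse (real P) * inverse (h P)))
        * (1 + 2 * (l / (sqrt (2 * pi) * \<sigma>)))) \<longlonglongrightarrow> 0"
    by (simp only: mult_zero_right mult_zero_left add_0)
  have V: "(\<lambda>P. prob_space.variance (M P) (Z P)) \<longlonglongrightarrow> 0"
  proof (rule tendsto_sandwich[OF _ _ tendsto_const bound1])
    show "\<forall>\<^sub>F P in sequentially. 0 \<le> prob_space.variance (M P) (Z P)"
      by (simp add: integral_nonneg_AE)
  qed (rule eventually_sequentiallyI[of 1], rule var)
  have plim: "plim_const M (\<lambda>P \<omega>. Z P \<omega> - d P) 0"
    by (rule plim_const_0_if_mean_and_variance[OF assms(3) Zm Z2 bias V])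
  have "(\<lambda>P. prob_space.expectation (M P) (Z P)) \<longlonglongrightarrow> L \<longleftrightarrow> d \<longlonglongrightarrow> L" for L
    using Lim_transform[OF _ bias] Lim_transform2[OF _ bias] by blast
  with plim bias V show ?thesis
    unfolding Z_def d_def by (simp only: right_diff_distrib simp_thms)
qed

end
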